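(* For any fixed integers $k, r, p$ with $k \ge r \ge 1$ and $p \ge r$, the limit $$l(k,r,p) = \lim_{n\to\infty} \frac{L(n,k,r,p)}{\binom{n}{r}}$$ exists (as a finite real number).
   Context: $L(n,k,r,p)$ denotes the minimum size of an $(n,k,r,p)$-lottery system, where an $(n,k,r,p)$-lottery system is a system (set) of $k$-element subsets ("edges") of a set $V$ with $|V|=n$ such that for every $p$-element subset $P \subseteq V$ there is an edge $K$ with $|K \cap P| \ge r$. (This is considered for $n \ge \max(k,p)$, where the system of all $k$-element subsets qualifies.) *)

theory Defs
  imports Complex_Main
begin

definition lottery_system :: "'a set \<Rightarrow> nat \<Rightarrow> nat \<Rightarrow> nat \<Rightarrow> 'a set set \<Rightarrow> bool" where
  "lottery_system V k r p E \<longleftrightarrow>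
     (\<forall>K\<in>E. K \<subseteq> V \<and> card K = k) \<and>
     (\<forall>P. P \<subseteq> V \<and> card P = p \<longrightarrow> (\<exists>K\<in>E. r \<le> card (K \<inter> P)))"

(* The vertex set is fixed to be {..<n}; lottery_number_eq shows that any other choice of an
   n-element set gives the same number. For max k p <= n (and r <= min k p) the minimum is over
   a nonempty set, see lottery_system_all_subsets; for smaller n the value is irrelevant. *)
definition lottery_number :: "nat \<Rightarrow> nat \<Rightarrow> nat \<Rightarrow> nat \<Rightarrow> nat" where
  "lottery_number n k r p = (LEAST m. \<exists>E. lottery_system {..<n} k r p E \<and> card E = m)"

lemma lottery_system_all_subsets:
  assumes fin: "finite V" and kV: "k \<le> card V" and rk: "r \<le> k" and rp: "r \<le> p"
  shows "lottery_system V k r p {K. K \<subseteq> V \<and> card K = k}"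
proof -
  have "\<exists>K. K \<subseteq> V \<and> card K = k \<and> r \<le> card (K \<inter> P)" if P: "P \<subseteq> V" "card P = p" for P
  proof -
    obtain R where R: "R \<subseteq> P" "card R = r" "finite R"
      using obtain_subset_with_card_n[of r P] rp P by auto
    obtain K where K: "R \<subseteq> K" "K \<subseteq> V" "card K = k"
      using exists_subset_between[of R k V] R P fin kV rk by auto
    have "finite (K \<inter> P)" using K fin finite_subset by blast
    then have "card R \<le> card (K \<inter> P)" using R K by (intro card_mono) auto
    then show ?thesis using K R by auto
  qed
  then show ?thesis unfolding lottery_system_def by auto
qed

lemma lottery_system_image:
  assumes f: "bij_betw f V W" and E: "lottery_system V k r p E"
  shows "lottery_system W k r p ((`) f ` E) \<and> card ((`) f ` E) = card E"
proof -
  have inj: "inj_on f V" and im: "f ` V = W" using f by (auto simp: bij_betw_def)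
  have sub: "K \<subseteq> V" "card K = k" if "K \<in> E" for K
    using E that by (auto simp: lottery_system_def)
  have 1: "f ` K \<subseteq> W \<and> card (f ` K) = k" if "K \<in> E" for K
    using sub[OF that] im inj card_image[of f K] inj_on_subset by blast
  have 2: "\<exists>K\<in>E. r \<le> card (f ` K \<inter> Q)" if Q: "Q \<subseteq> W" "card Q = p" for Q
  proof -
    obtain P where P: "P \<subseteq> V" "Q = f ` P" using Q im subset_image_iff by metis
    have "card P = p" using P Q inj card_image[of f P] inj_on_subset by metis
    then obtain K where K: "K \<in> E" "r \<le> card (K \<inter> P)"
      using E P by (auto simp: lottery_system_def)
    have "f ` K \<inter> Q = f ` (K \<inter> P)"
      using inj_on_image_Int[OF inj sub(1)[OF K(1)] P(1)] P by simp
    moreover have "card (f ` (K \<inter> P)) = card (K \<inter> P)"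
      using inj P by (intro card_image) (auto intro: inj_on_subset)
    ultimately show ?thesis using K by metis
  qed
  have "inj_on ((`) f) E"
    using inj sub(1) by (auto intro!: inj_onI simp: inj_on_image_eq_iff)
  then show ?thesis using 1 2 by (auto simp: lottery_system_def card_image)
qed

lemma lottery_number_eq:
  assumes "finite V" and "card V = n"
  shows "lottery_number n k r p = (LEAST m. \<exists>E. lottery_system V k r p E \<and> card E = m)"
proof -
  obtain f where f: "bij_betw f V {..<n}"
    using assms finite_same_card_bij[of V "{..<n}"] by auto
  have "(\<exists>E. lottery_system {..<n} k r p E \<and> card E = m) \<longleftrightarrow>
        (\<exists>E. lottery_system V k r p E \<and> card E = m)" for m
    using lottery_system_image[OF f] lottery_system_image[OF bij_betw_inv_into[OF f]] by metis
  then show ?thesis by (simp add: lottery_number_def)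
qed

end

theory Submission
  imports Defs "HOL-Library.FuncSet" "HOL-Number_Theory.Cong"
    "HOL-Computational_Algebra.Polynomial"
begin

text \<open>Write \<open>a n = L(n,k,r,p) / n ^ r\<close>. Blow up an optimal system on \<open>m\<close> points, replacing every
  point by \<open>t\<close> copies. If \<open>t\<close> is coprime to all positive integers below \<open>k\<close>, an orthogonal array with
  \<open>t ^ r\<close> rows covers all transversal \<open>r\<close>-sets over an edge, and only a fraction \<open>O(1/m)\<close> of the
  \<open>r\<close>-sets needs further edges. Hence \<open>a (m * t) \<le> a m + p / m\<close>. Since \<open>L\<close> is nondecreasing in \<open>n\<close> and the
  admissible \<open>t\<close> have bounded gaps, \<open>limsup a \<le> a m + p / m\<close> for every \<open>m \<ge> k\<close>, so \<open>a\<close> converges.\<close>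

section \<open>Interpolation modulo \<open>t\<close> and orthogonal arrays\<close>

text \<open>Newton interpolation: a multiple of the polynomial vanishing on the old nodes corrects
  the value at the new one, and coprime differences make the needed factor invertible mod
  \<open>t\<close>. The degree bound is put on coefficients so that \<open>q = 0\<close> fits the
  empty set, where \<open>degree q < card A\<close> would fail.\<close>

lemma interpolation_mod:
  fixes A :: "int set" and t :: int
  assumes "finite A" and "\<And>x y. x \<in> A \<Longrightarrow> y \<in> A \<Longrightarrow> x \<noteq> y \<Longrightarrow> coprime (x - y) t"
  shows "\<exists>q. (\<forall>i\<ge>card A. coeff q i = 0) \<and> (\<forall>x\<in>A. [poly q x = f x] (mod t))"
  using assms
proof (induction A rule: finite_induct)
  case empty
  show ?case by (rule exI[of _ 0]) simp
next
  case (insert x A)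
  obtain q where q: "\<forall>i\<ge>card A. coeff q i = 0" "\<forall>x\<in>A. [poly q x = f x] (mod t)"
    using insert.IH insert.prems by auto
  let ?N = "\<Prod>y\<in>A. [:-y, 1:]"
  have "coprime (\<Prod>y\<in>A. x - y) t"
    using insert.prems insert.hyps by (intro prod_coprime_left) auto
  then obtain u where u: "[(\<Prod>y\<in>A. x - y) * u = 1] (mod t)"
    using cong_solve_coprime_int by blast
  \<comment> \<open>\<open>smult c ?N\<close> vanishes on \<open>A\<close>, and its value at
    \<open>x\<close> is congruent mod \<open>t\<close> to the missing
    \<open>f x - poly q x\<close>.\<close>
  define c where "c = u * (f x - poly q x)"
  let ?q = "q + smult c ?N"
  have degN: "degree ?N = card A"
    by (subst degree_prod_eq_sum_degree) auto
  have "coeff ?q i = 0" if "i \<ge> card (insert x A)" for i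
    using that q insert.hyps degN by (simp add: coeff_eq_0)
  moreover have "[poly ?q y = f y] (mod t)" if "y \<in> A" for y
  proof -
    have "poly ?N y = 0" using that insert.hyps by (auto simp: poly_prod)
    then show ?thesis using q that by simp
  qed
  moreover have "[poly ?q x = f x] (mod t)"
  proof -
    have "[((\<Prod>y\<in>A. x - y) * u) * (f x - poly q x) = 1 * (f x - poly q x)] (mod t)"
      using u by (intro cong_mult) auto
    then have "[poly q x + ((\<Prod>y\<in>A. x - y) * u) * (f x - poly q x)
      = poly q x + 1 * (f x - poly q x)] (mod t)"
      by (intro cong_add) auto
    then show ?thesis by (simp add: poly_prod c_def algebra_simps)
  qed
  ultimately show ?case by (intro exI[of _ ?q]) auto
qed

text \<open>Distinct points of \<open>{..<k}\<close> differ by less than \<open>k\<close>, so their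
  differences are coprime to \<open>t\<close> and interpolation applies. Each coefficient vector
  \<open>a\<close> gives one row of the array.\<close>

lemma orthogonal_array_covers:
  fixes t :: nat
  assumes t: "0 < t" and cop: "\<And>d. 0 < d \<Longrightarrow> d < k \<Longrightarrow> coprime d t"
    and I: "I \<subseteq> {..<k}" "card I = r" and f: "\<And>i. i \<in> I \<Longrightarrow> f i < t"
  shows "\<exists>a\<in>{..<r} \<rightarrow>\<^sub>E {..<t}. \<forall>i\<in>I. (\<Sum>j<r. a j * i ^ j) mod t = f i"
proof -
  have fin: "finite (int ` I)" using I finite_subset by blast
  have cI: "card (int ` I) = r" using I by (simp add: card_image)
  have "coprime (x - y) (int t)" if "x \<in> int ` I" "y \<in> int ` I" "x \<noteq> y" for x y
  proof -
    have "0 \<le> x" "x < int k" "0 \<le> y" "y < int k" using that I by auto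
    then have "coprime (nat \<bar>x - y\<bar>) t" using that(3) by (intro cop) auto
    then have "coprime (int (nat \<bar>x - y\<bar>)) (int t)" by (simp only: coprime_int_iff)
    then show ?thesis by simp
  qed
  from interpolation_mod[OF fin this, of "\<lambda>x. int (f (nat x))"]
  obtain q where q: "\<forall>i\<ge>r. coeff q i = 0"
    "\<forall>i\<in>I. [poly q (int i) = int (f i)] (mod int t)" by (auto simp: cI)
  \<comment> \<open>Reducing the coefficients mod \<open>t\<close> keeps the values mod
    \<open>t\<close> and leaves only \<open>t ^ r\<close> possible vectors.\<close>
  define a where "a = restrict (\<lambda>j. nat (coeff q j mod int t)) {..<r}"
  have "a \<in> {..<r} \<rightarrow>\<^sub>E {..<t}" using t by (auto simp: a_def nat_less_iff)
  moreover have "(\<Sum>j<r. a j * i ^ j) mod t = f i" if i: "i \<in> I" for i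
  proof -
    have "[int (a j) * int i ^ j = coeff q j * int i ^ j] (mod int t)" if "j < r" for j
      using t that by (intro cong_mult) (auto simp: a_def)
    then have "[(\<Sum>j<r. int (a j) * int i ^ j) = (\<Sum>j<r. coeff q j * int i ^ j)] (mod int t)"
      by (intro cong_sum) auto
    also have "(\<Sum>j<r. coeff q j * int i ^ j) = poly q (int i)"
    \<comment> \<open>The zero polynomial has degree 0, which is not below \<open>r\<close> when
      \<open>r = 0\<close>.\<close>
    proof (cases "q = 0")
      case False
      then have "degree q < r" using q(1) leading_coeff_neq_0 linorder_not_le by blast
      then show ?thesis unfolding poly_altdef
        by (intro sum.mono_neutral_right) (auto simp: coeff_eq_0)
    qed simp
    also have "[poly q (int i) = int (f i)] (mod int t)" using q i by blast
    finally have "[int (\<Sum>j<r. a j * i ^ j) = int (f i)] (mod int t)" by simp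
    then have "[(\<Sum>j<r. a j * i ^ j) = f i] (mod t)" by (simp only: cong_int_iff)
    then show ?thesis using f[OF i] by (simp add: cong_def)
  qed
  ultimately show ?thesis by blast
qed

section \<open>Attainment and monotonicity of lottery numbers\<close>

lemma lottery_system_finite:
  "finite V \<Longrightarrow> lottery_system V k r p E \<Longrightarrow> finite E"
  by (rule finite_subset[of E "Pow V"]) (auto simp: lottery_system_def)

lemma lottery_number_le:
  assumes "finite V" and "lottery_system V k r p E"
  shows "lottery_number (card V) k r p \<le> card E"
  unfolding lottery_number_eq[OF assms(1) refl]
  by (rule Least_le) (use assms(2) in blast)

lemma lottery_number_attained:
  assumes "k \<le> n" and "r \<le> k" and "r \<le> p"
  obtains E where "lottery_system {..<n} k r p E" and "card E = lottery_number n k r p"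
proof -
  have "\<exists>E. lottery_system {..<n} k r p E \<and> card E = lottery_number n k r p"
    unfolding lottery_number_def
  proof (rule LeastI_ex)
    have "k \<le> card {..<n}" using assms by simp
    from lottery_system_all_subsets[OF finite_lessThan this assms(2,3)]
    show "\<exists>m E. lottery_system {..<n} k r p E \<and> card E = m" by blast
  qed
  then show ?thesis using that by blast
qed

lemma extend_to_card:
  assumes "finite V" and "S \<subseteq> V" and "card S \<le> k" and "k \<le> card V"
  defines "K \<equiv> SOME K. S \<subseteq> K \<and> K \<subseteq> V \<and> card K = k"
  shows "S \<subseteq> K" and "K \<subseteq> V" and "card K = k"
proof -
  have "\<exists>K. S \<subseteq> K \<and> K \<subseteq> V \<and> card K = k"
    using exists_subset_between[OF assms(3,4,2,1)] by blast
  then have "S \<subseteq> K \<and> K \<subseteq> V \<and> card K = k" unfolding K_def by (rule someI_ex)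
  then show "S \<subseteq> K" "K \<subseteq> V" "card K = k" by simp_all
qed

text \<open>A set \<open>P\<close> inside \<open>{..<n}\<close> meets an edge only in the trace of
  that edge on \<open>{..<n}\<close>, so the traces, padded back to size \<open>k\<close>, form a
  system with no more edges.\<close>

lemma lottery_number_mono:
  assumes kn: "k \<le> n" and nN: "n \<le> N" and rk: "r \<le> k" and rp: "r \<le> p"
  shows "lottery_number n k r p \<le> lottery_number N k r p"
proof -
  obtain E where E: "lottery_system {..<N} k r p E" "card E = lottery_number N k r p"
    using lottery_number_attained[of k N] assms by auto
  define g where "g K = (SOME K'. K \<inter> {..<n} \<subseteq> K' \<and> K' \<subseteq> {..<n} \<and> card K' = k)" for K
  have g: "K \<inter> {..<n} \<subseteq> g K" "g K \<subseteq> {..<n}" "card (g K) = k" if "K \<in> E" for K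
  proof -
    have "finite K" "card K = k"
      using that E finite_subset[of K "{..<N}"] by (auto simp: lottery_system_def)
    then have "card (K \<inter> {..<n}) \<le> k" using card_mono[of K "K \<inter> {..<n}"] by auto
    then show "K \<inter> {..<n} \<subseteq> g K" "g K \<subseteq> {..<n}" "card (g K) = k"
      using extend_to_card[of "{..<n}" "K \<inter> {..<n}" k] kn by (auto simp: g_def)
  qed
  have "lottery_system {..<n} k r p (g ` E)"
    unfolding lottery_system_def
  proof (intro conjI allI impI)
    fix P assume P: "P \<subseteq> {..<n} \<and> card P = p"
    then have "P \<subseteq> {..<N}" using nN by auto
    then obtain K where K: "K \<in> E" "r \<le> card (K \<inter> P)"
      using E P by (auto simp: lottery_system_def)
    have "card (K \<inter> P) \<le> card (g K \<inter> P)"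
      using g[OF K(1)] P finite_subset[of P "{..<n}"] by (intro card_mono) auto
    then have "r \<le> card (g K \<inter> P)" using K by simp
    then show "\<exists>K\<in>g ` E. r \<le> card (K \<inter> P)" using K by blast
  next
    show "\<forall>K\<in>g ` E. K \<subseteq> {..<n} \<and> card K = k" using g(2,3) by (simp add: image_iff)
  qed
  from lottery_number_le[OF _ this]
  have "lottery_number n k r p \<le> card (g ` E)" by (metis card_lessThan finite_lessThan)
  also have "\<dots> \<le> card E"
    using lottery_system_finite[OF _ E(1)] by (intro card_image_le) auto
  finally show ?thesis using E by simp
qed

section \<open>Blow-up of a lottery system\<close>

text \<open>Each edge of the small system is replaced by the words of a Reed--Solomon code over the
  integers mod \<open>t\<close>, which cover every transversal \<open>r\<close>-set over that edge; the sets in \<open>B\<close> take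
  care of the \<open>p\<close>-sets whose projection is not caught by the small system.\<close>

lemma lottery_number_blowup:
  fixes t m :: nat
  assumes t: "0 < t" and cop: "\<And>d. 0 < d \<Longrightarrow> d < k \<Longrightarrow> coprime d t"
    and km: "k \<le> m" and rk: "r \<le> k"
    and E: "lottery_system {..<m} k r p E"
    and B: "finite B" "\<And>R. R \<in> B \<Longrightarrow> R \<subseteq> {..<m} \<times> {..<t} \<and> card R = r"
    and hit: "\<And>P. P \<subseteq> {..<m} \<times> {..<t} \<Longrightarrow> card P = p \<Longrightarrow>
      (\<exists>K\<in>E. r \<le> card (K \<inter> fst ` P)) \<or> (\<exists>R\<in>B. R \<subseteq> P)"
  shows "lottery_number (m * t) k r p \<le> card E * t ^ r + card B"
proof -
  let ?V = "{..<m} \<times> {..<t}"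
  \<comment> \<open>The labels in \<open>{..<k}\<close> serve as evaluation points: differences of
    the vertices themselves may share factors with \<open>t\<close>.\<close>
  define idx where "idx K = (SOME f::nat \<Rightarrow> nat. bij_betw f K {..<k})" for K :: "nat set"
  have K: "finite K" "K \<subseteq> {..<m}" "card K = k" "bij_betw (idx K) K {..<k}" if "K \<in> E" for K
  proof -
    show *: "K \<subseteq> {..<m}" "card K = k" using that E by (auto simp: lottery_system_def)
    show "finite K" using * finite_subset by blast
    then have "\<exists>f. bij_betw f K {..<k}" using * finite_same_card_bij[of K "{..<k}"] by auto
    then show "bij_betw (idx K) K {..<k}" unfolding idx_def by (rule someI_ex)
  qed
  \<comment> \<open>The graph over \<open>K\<close> of the polynomial with coefficients
    \<open>a\<close>, hence a transversal with \<open>k\<close> points.\<close>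
  define edge where
    "edge = (\<lambda>(K, a). (\<lambda>v. (v, (\<Sum>j<r. a j * idx K v ^ j) mod t)) ` K)"
  let ?A = "E \<times> ({..<r} \<rightarrow>\<^sub>E {..<t})"
  define ext where "ext R = (SOME K. R \<subseteq> K \<and> K \<subseteq> ?V \<and> card K = k)" for R
  have "m * 1 \<le> m * t" using t by (intro mult_le_mono2) simp
  then have "k \<le> m * t" using km by linarith
  then have "k \<le> card ?V" by simp
  then have ext: "R \<subseteq> ext R" "ext R \<subseteq> ?V" "card (ext R) = k" if "R \<in> B" for R
    using extend_to_card[of ?V R k] B(2)[OF that] rk by (auto simp: ext_def)
  let ?F = "edge ` ?A \<union> ext ` B"
  have finE: "finite E" using lottery_system_finite[OF _ E] by simp
  have "lottery_system ?V k r p ?F"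
    unfolding lottery_system_def
  proof (intro conjI allI impI ballI)
    fix X assume X: "X \<in> ?F"
    have "edge (K, a) \<subseteq> ?V" "card (edge (K, a)) = k" if "K \<in> E" for K a
      using K[OF that] t by (auto simp: edge_def card_image inj_on_def)
    then show "X \<subseteq> ?V" "card X = k" using X ext(2,3) by blast+
  next
    fix P assume P: "P \<subseteq> ?V \<and> card P = p"
    then have finP: "finite P" using finite_subset[of P ?V] by auto
    from hit[of P] P consider K' where "K' \<in> E" "r \<le> card (K' \<inter> fst ` P)"
      | R where "R \<in> B" "R \<subseteq> P" by blast
    then show "\<exists>X\<in>?F. r \<le> card (X \<inter> P)"
    proof cases
      case (1 K')
      obtain S where S: "S \<subseteq> K' \<inter> fst ` P" "card S = r" "finite S"
        using obtain_subset_with_card_n[OF 1(2)] .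
      then have "\<forall>v\<in>S. \<exists>y. (v, y) \<in> P" by force
      \<comment> \<open>\<open>h\<close> selects one point of \<open>P\<close> above each vertex of
        \<open>S\<close>; a code word through all \<open>r\<close> of them is wanted.\<close>
      then obtain h where h: "\<And>v. v \<in> S \<Longrightarrow> (v, h v) \<in> P" by metis
      have bij: "bij_betw (idx K') K' {..<k}" using K 1 by blast
      then have inj: "inj_on (idx K') K'" by (auto simp: bij_betw_def)
      let ?g = "inv_into K' (idx K')"
      have g: "?g (idx K' v) = v" if "v \<in> S" for v
        using inv_into_f_f[OF inj] that S by auto
      have "\<exists>a\<in>{..<r} \<rightarrow>\<^sub>E {..<t}. \<forall>i\<in>idx K' ` S. (\<Sum>j<r. a j * i ^ j) mod t = h (?g i)"
      proof (rule orthogonal_array_covers[OF t cop])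
        show "idx K' ` S \<subseteq> {..<k}" using bij S by (auto simp: bij_betw_def)
        show "card (idx K' ` S) = r"
          using S inj inj_on_subset[of "idx K'" K' S] by (simp add: card_image)
        fix i assume "i \<in> idx K' ` S"
        then obtain v where "v \<in> S" "?g i = v" using g by auto
        then show "h (?g i) < t" using h P by auto
      qed
      then obtain a where a: "a \<in> {..<r} \<rightarrow>\<^sub>E {..<t}"
        "\<And>v. v \<in> S \<Longrightarrow> (\<Sum>j<r. a j * idx K' v ^ j) mod t = h v" using g by auto
      have "(\<lambda>v. (v, h v)) ` S \<subseteq> edge (K', a) \<inter> P"
      proof (rule image_subsetI)
        fix v assume v: "v \<in> S"
        then have "v \<in> K'" using S by blast
        then have "(v, h v) \<in> edge (K', a)" using a(2)[OF v] by (auto simp: edge_def)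
        then show "(v, h v) \<in> edge (K', a) \<inter> P" using h[OF v] by blast
      qed
      then have "card ((\<lambda>v. (v, h v)) ` S) \<le> card (edge (K', a) \<inter> P)"
        using finP by (intro card_mono finite_Int) blast+
      then have "r \<le> card (edge (K', a) \<inter> P)"
        using S by (simp add: card_image inj_on_def)
      then show ?thesis using 1 a by blast
    next
      case (2 R)
      have "card R \<le> card (ext R \<inter> P)" using ext[OF 2(1)] 2 finP by (intro card_mono) auto
      then show ?thesis using 2 B by auto
    qed
  qed
  from lottery_number_le[OF _ this]
  have "lottery_number (m * t) k r p \<le> card ?F" by (simp add: card_cartesian_product)
  also have "\<dots> \<le> card (edge ` ?A) + card (ext ` B)" by (rule card_Un_le)
  also have "\<dots> \<le> card ?A + card B"
    using finE B by (intro add_mono card_image_le finite_cartesian_product finite_PiE) auto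
  also have "card ?A = card E * t ^ r" by (simp add: card_cartesian_product card_PiE)
  finally show ?thesis .
qed

text \<open>Two points of \<open>R\<close> lie over one vertex, which leaves
  \<open>m * t * t\<close> choices for them and \<open>(m * t) ^ (r - 2)\<close> lists for the rest:
  a factor \<open>m\<close> below \<open>(m * t) ^ r\<close>.\<close>

lemma card_nontransversal_le:
  fixes m t r :: nat
  assumes r: "2 \<le> r"
  shows "card {R. R \<subseteq> {..<m} \<times> {..<t} \<and> card R = r \<and> \<not> inj_on fst R} * m \<le> (m * t) ^ r"
proof -
  let ?V = "{..<m} \<times> {..<t}"
  let ?B = "{R. R \<subseteq> ?V \<and> card R = r \<and> \<not> inj_on fst R}"
  let ?L = "{xs. set xs \<subseteq> ?V \<and> length xs = r - 2}"
  let ?T = "({..<m} \<times> {..<t} \<times> {..<t}) \<times> ?L"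
  have finL: "finite ?L" by (rule finite_lists_length_eq) simp
  have sub: "?B \<subseteq> (\<lambda>((v, i, j), xs). insert (v, i) (insert (v, j) (set xs))) ` ?T"
  proof
    fix R assume "R \<in> ?B"
    then have R: "R \<subseteq> ?V" "card R = r" "\<not> inj_on fst R" by auto
    then have finR: "finite R" using finite_subset[of R ?V] by auto
    obtain v i j where vij: "(v, i) \<in> R" "(v, j) \<in> R" "i \<noteq> j"
      using R(3) by (fastforce simp: inj_on_def)
    obtain xs where xs: "set xs = R - {(v, i), (v, j)}" "distinct xs"
      using finite_distinct_list[of "R - {(v, i), (v, j)}"] finR by auto
    have "length xs = r - 2"
      using xs vij R finR by (simp add: distinct_card[symmetric] card_Diff_subset)
    then have "((v, i, j), xs) \<in> ?T" using xs R vij by auto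
    moreover have "R = insert (v, i) (insert (v, j) (set xs))" using xs vij by auto
    ultimately show "R \<in> (\<lambda>((v, i, j), xs). insert (v, i) (insert (v, j) (set xs))) ` ?T"
      by (intro rev_image_eqI[of "((v, i, j), xs)"]) simp_all
  qed
  have "card ?B \<le> card ((\<lambda>((v, i, j), xs). insert (v, i) (insert (v, j) (set xs))) ` ?T)"
    by (rule card_mono[OF _ sub]) (intro finite_imageI finite_cartesian_product finite_lessThan finL)
  also have "\<dots> \<le> card ?T"
    by (intro card_image_le finite_cartesian_product finite_lessThan finL)
  also have "\<dots> = m * t * t * (m * t) ^ (r - 2)"
    by (simp add: card_cartesian_product card_lists_length_eq)
  finally have "card ?B * m \<le> m * t * t * (m * t) ^ (r - 2) * m" by (rule mult_le_mono1)
  also have "\<dots> = (m * t) ^ (2 + (r - 2))"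
    by (simp add: power_add power2_eq_square algebra_simps)
  also have "2 + (r - 2) = r" using r by simp
  finally show ?thesis .
qed

text \<open>\<open>b\<close> counts the repairing sets. For \<open>r \<ge> 2\<close>, a
  \<open>p\<close>-set with two points in one fibre contains a nontransversal \<open>r\<close>-set.
  For \<open>r = 1\<close> there are no nontransversal \<open>r\<close>-sets, and the points over
  uncovered vertices are used instead.\<close>

lemma lottery_number_blowup_le:
  fixes t m :: nat
  assumes t: "0 < t" and cop: "\<And>d. 0 < d \<Longrightarrow> d < k \<Longrightarrow> coprime d t"
    and km: "k \<le> m" and r1: "1 \<le> r" and rk: "r \<le> k" and rp: "r \<le> p"
  shows "\<exists>b. lottery_number (m * t) k r p \<le> lottery_number m k r p * t ^ r + b
    \<and> b * m \<le> p * (m * t) ^ r"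
proof -
  let ?V = "{..<m} \<times> {..<t}"
  obtain E where E: "lottery_system {..<m} k r p E" "card E = lottery_number m k r p"
    using lottery_number_attained km rk rp by blast
  show ?thesis
  proof (cases "r = 1")
    case True
    let ?U = "{..<m} - \<Union>E"
    let ?B = "(\<lambda>x. {x}) ` (?U \<times> {..<t})"
    \<comment> \<open>More uncovered vertices than that would contain a \<open>p\<close>-set
      disjoint from every edge.\<close>
    have "card ?U \<le> p"
    proof (rule ccontr)
      assume "\<not> card ?U \<le> p"
      then have "p \<le> card ?U" by simp
      then obtain P where P: "P \<subseteq> ?U" "card P = p" using obtain_subset_with_card_n by metis
      then obtain K where "K \<in> E" "r \<le> card (K \<inter> P)"
        using E unfolding lottery_system_def by blast
      moreover from \<open>K \<in> E\<close> P have "K \<inter> P = {}" by auto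
      ultimately show False using True by simp
    qed
    have "lottery_number (m * t) k r p \<le> card E * t ^ r + card ?B"
    proof (rule lottery_number_blowup[OF t cop km rk E(1)])
      fix P :: "(nat \<times> nat) set" assume P: "P \<subseteq> ?V" "card P = p"
      then obtain x where x: "x \<in> P" using r1 rp by (cases "P = {}") auto
      show "(\<exists>K\<in>E. r \<le> card (K \<inter> fst ` P)) \<or> (\<exists>R\<in>?B. R \<subseteq> P)"
      proof (cases "fst x \<in> \<Union>E")
        case True
        then obtain K where K: "K \<in> E" "fst x \<in> K" by auto
        have "finite P" using P finite_subset[of P ?V] by auto
        then have "card {fst x} \<le> card (K \<inter> fst ` P)" using K x by (intro card_mono) auto
        then have "r \<le> card (K \<inter> fst ` P)" using \<open>r = 1\<close> by simp
        then show ?thesis using K by blast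
      next
        case False
        moreover have "x \<in> ?V" using x P by blast
        ultimately have "x \<in> ?U \<times> {..<t}" by (simp add: mem_Times_iff)
        then have "{x} \<in> ?B" by (rule imageI)
        then show ?thesis using x by blast
      qed
    next
      show "finite ?B" by simp
    next
      fix R assume "R \<in> ?B"
      then obtain x where "R = {x}" "x \<in> ?V" by blast
      then show "R \<subseteq> ?V \<and> card R = r" using True by simp
    qed
    moreover have "card ?B * m \<le> p * (m * t) ^ r"
    proof -
      have "card ?B = card ?U * t" by (simp add: card_image card_cartesian_product)
      also have "\<dots> * m \<le> p * t * m" using \<open>card ?U \<le> p\<close> by (intro mult_le_mono1)
      finally show ?thesis using True by (simp add: algebra_simps)
    qed
    ultimately show ?thesis unfolding E(2) by blast
  next
    case False
    then have r2: "2 \<le> r" using r1 by simp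
    let ?B = "{R. R \<subseteq> ?V \<and> card R = r \<and> \<not> inj_on fst R}"
    have "lottery_number (m * t) k r p \<le> card E * t ^ r + card ?B"
    proof (rule lottery_number_blowup[OF t cop km rk E(1)])
      show "finite ?B" by (rule finite_subset[of _ "Pow ?V"]) auto
    next
      fix P :: "(nat \<times> nat) set" assume P: "P \<subseteq> ?V" "card P = p"
      show "(\<exists>K\<in>E. r \<le> card (K \<inter> fst ` P)) \<or> (\<exists>R\<in>?B. R \<subseteq> P)"
      proof (cases "inj_on fst P")
        case True
        then have "card (fst ` P) = p" using P by (simp add: card_image)
        moreover have "fst ` P \<subseteq> {..<m}" using P by auto
        ultimately show ?thesis using E(1) unfolding lottery_system_def by blast
      next
        case False
        then obtain x y where xy: "x \<in> P" "y \<in> P" "fst x = fst y" "x \<noteq> y"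
          unfolding inj_on_def by blast
        have "finite P" using P finite_subset[of P ?V] by auto
        moreover have "card {x, y} \<le> r" "r \<le> card P" "{x, y} \<subseteq> P" using xy r2 rp P by auto
        ultimately obtain R where R: "{x, y} \<subseteq> R" "R \<subseteq> P" "card R = r"
          using exists_subset_between[of "{x, y}" r P] by blast
        then have "\<not> inj_on fst R" using xy unfolding inj_on_def by blast
        then have "R \<in> ?B" using R P by blast
        then show ?thesis using R by blast
      qed
    next
      fix R assume "R \<in> ?B"
      then show "R \<subseteq> ?V \<and> card R = r" by blast
    qed
    moreover have "card ?B * m \<le> p * (m * t) ^ r"
    proof -
      \<comment> \<open>The factor \<open>p \<ge> 1\<close> weakens the bound only to match the case
        \<open>r = 1\<close>.\<close>
      have "1 * (m * t) ^ r \<le> p * (m * t) ^ r" using rp r1 by (intro mult_le_mono1) simp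
      then show ?thesis using card_nontransversal_le[OF r2, of m t] by linarith
    qed
    ultimately show ?thesis unfolding E(2) by blast
  qed
qed

section \<open>Two facts on limits\<close>

text \<open>The limit is the infimum of \<open>a m + b m\<close> over \<open>m \<ge> M\<close>. For
  fixed \<open>m\<close> the factor \<open>(1 + c m / real n) ^ r\<close> tends to 1, which bounds
  \<open>a n\<close> from above; from below, \<open>a n \<ge> l - b n\<close> and \<open>b n\<close>
  tends to 0.\<close>

lemma convergent_of_self_bound:
  fixes a b :: "nat \<Rightarrow> real" and c :: "nat \<Rightarrow> real"
  assumes nonneg: "\<And>n. 0 \<le> a n" and b: "\<And>n. 0 \<le> b n" "b \<longlonglongrightarrow> 0"
    and bound: "\<And>m n. M \<le> m \<Longrightarrow> M \<le> n \<Longrightarrow> a n \<le> (a m + b m) * (1 + c m / real n) ^ r"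
  shows "\<exists>l. a \<longlonglongrightarrow> l"
proof -
  let ?S = "(\<lambda>m. a m + b m) ` {M..}"
  define l where "l = Inf ?S"
  have bdd: "bdd_below ?S" using nonneg b by (intro bdd_belowI[of _ 0]) auto
  have "a \<longlonglongrightarrow> l"
  proof (rule order_tendstoI)
    fix x assume "l < x"
    then obtain m where m: "M \<le> m" "a m + b m < x"
      using cInf_less_iff[OF _ bdd, of x] by (auto simp: l_def)
    have "(\<lambda>n. (a m + b m) * (1 + c m / real n) ^ r) \<longlonglongrightarrow> (a m + b m) * (1 + 0) ^ r"
      by (intro tendsto_intros lim_const_over_n)
    then have "\<forall>\<^sub>F n in sequentially. (a m + b m) * (1 + c m / real n) ^ r < x"
      using m by (intro order_tendstoD(2)) auto
    then show "\<forall>\<^sub>F n in sequentially. a n < x"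
      using eventually_ge_at_top[of M]
      by eventually_elim (use bound[OF m(1)] in \<open>meson order_le_less_trans\<close>)
  next
    fix x assume "x < l"
    then have "\<forall>\<^sub>F n in sequentially. b n < l - x"
      using b by (intro order_tendstoD(2)) auto
    then show "\<forall>\<^sub>F n in sequentially. x < a n"
      using eventually_ge_at_top[of M]
    proof eventually_elim
      case (elim n)
      have "l \<le> a n + b n" unfolding l_def using bdd elim by (intro cInf_lower) auto
      then show ?case using elim by simp
    qed
  qed
  then show ?thesis ..
qed

text \<open>Allows normalising by \<open>n ^ r\<close>, which is multiplicative in \<open>n\<close>,
  and returning to the binomial coefficient at the end.\<close>

lemma power_over_binomial_tendsto:
  "(\<lambda>n. real n ^ r / real (n choose r)) \<longlonglongrightarrow> fact r"
proof -
  have "(\<lambda>n. fact r / (\<Prod>i<r. 1 - real i / real n)) \<longlonglongrightarrow> fact r / (\<Prod>i<r. 1 - 0)"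
    by (intro tendsto_intros lim_const_over_n) auto
  then have "(\<lambda>n. fact r / (\<Prod>i<r. 1 - real i / real n)) \<longlonglongrightarrow> fact r" by simp
  moreover have "\<forall>\<^sub>F n in sequentially.
      fact r / (\<Prod>i<r. 1 - real i / real n) = real n ^ r / real (n choose r)"
    \<comment> \<open>For \<open>0 < n < r\<close> both denominators are 0, so both quotients are 0
      by convention; only \<open>n = 0\<close> is excluded.\<close>
    using eventually_gt_at_top[of 0]
  proof eventually_elim
    case (elim n)
    have "(\<Prod>i<r. 1 - real i / real n) = (\<Prod>i<r. (real n - real i) / real n)"
      using elim by (intro prod.cong) (auto simp: field_simps)
    also have "\<dots> = (\<Prod>i<r. real n - real i) / real n ^ r" by (simp add: prod_dividef)
    also have "(\<Prod>i<r. real n - real i) = real (n choose r) * fact r"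
      by (simp add: binomial_gbinomial gbinomial_prod_rev lessThan_atLeast0)
    finally show ?case by simp
  qed
  ultimately show ?thesis by (rule Lim_transform_eventually)
qed

section \<open>Comparison of ratios and convergence\<close>

text \<open>By monotonicity \<open>n\<close> may be enlarged to \<open>m * t\<close> with
  \<open>t\<close> congruent to 1 modulo \<open>fact k\<close>, where the blow-up applies. The
  overshoot is at most \<open>m * (fact k + 1)\<close>, whatever \<open>n\<close> is.\<close>

lemma lottery_ratio_bound:
  fixes k r p m n :: nat
  assumes r1: "1 \<le> r" and rk: "r \<le> k" and rp: "r \<le> p" and m: "k \<le> m" and n: "k \<le> n"
  defines "a \<equiv> \<lambda>n. real (lottery_number n k r p) / real n ^ r"
  shows "a n \<le> (a m + real p / real m) * (1 + real (m * (fact k + 1)) / real n) ^ r"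
proof -
  \<comment> \<open>\<open>s\<close> is the least number with \<open>n < m * fact k * s\<close>,
    whence the bounds \<open>lo\<close> and \<open>hi\<close>.\<close>
  define s where "s = n div (m * fact k) + 1"
  define t :: nat where "t = fact k * s + 1"
  have pos: "0 < m" "0 < n" "0 < t" using assms by (auto simp: t_def)
  have cop: "coprime d t" if "0 < d" "d < k" for d
  proof -
    \<comment> \<open>Consecutive numbers are coprime, and every positive \<open>d < k\<close>
      divides the smaller one.\<close>
    have "coprime (fact k * s) t" unfolding t_def by simp
    moreover have "d dvd fact k * s" using that by (intro dvd_mult2 dvd_fact) auto
    ultimately show ?thesis using coprime_divisors[of d _ t t] by auto
  qed
  have split: "m * fact k * (n div (m * fact k)) + n mod (m * fact k) = n" by simp
  have "n mod (m * fact k) < m * fact k" using pos by simp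
  then have lo: "n \<le> m * t"
    using split by (simp add: t_def s_def algebra_simps)
  have hi: "m * t \<le> n + m * (fact k + 1)"
    using split by (simp add: t_def s_def algebra_simps)
  obtain b where b: "lottery_number (m * t) k r p \<le> lottery_number m k r p * t ^ r + b"
    "b * m \<le> p * (m * t) ^ r"
    using lottery_number_blowup_le[OF pos(3) cop m r1 rk rp] by blast
  have "real (lottery_number n k r p) \<le> real (lottery_number m k r p * t ^ r + b)"
    using lottery_number_mono[OF n lo rk rp] b by linarith
  also have "\<dots> \<le> (a m + real p / real m) * real (m * t) ^ r"
  proof -
    have "real b * real m \<le> real p * real (m * t) ^ r"
      using b(2) by (metis of_nat_le_iff of_nat_mult of_nat_power)
    then have "real b \<le> real p / real m * real (m * t) ^ r"
      using pos by (simp add: field_simps)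
    moreover have "real (lottery_number m k r p * t ^ r) = a m * real (m * t) ^ r"
      using pos by (simp add: a_def power_mult_distrib)
    ultimately show ?thesis by (simp add: distrib_right)
  qed
  finally have "a n \<le> (a m + real p / real m) * (real (m * t) ^ r / real n ^ r)"
    using pos by (simp add: a_def field_simps)
  also have "real (m * t) ^ r / real n ^ r = (real (m * t) / real n) ^ r"
    by (simp add: power_divide)
  also have "(a m + real p / real m) * \<dots>
      \<le> (a m + real p / real m) * (1 + real (m * (fact k + 1)) / real n) ^ r"
  proof (intro mult_left_mono power_mono)
    have "real (m * t) \<le> real n + real (m * (fact k + 1))"
      using hi by (metis of_nat_add of_nat_le_iff)
    then have "real (m * t) / real n \<le> (real n + real (m * (fact k + 1))) / real n"
      by (rule divide_right_mono) simp
    then show "real (m * t) / real n \<le> 1 + real (m * (fact k + 1)) / real n"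
      using pos by (simp add: add_divide_distrib)
  qed (auto simp: a_def)
  finally show ?thesis .
qed

theorem mainTheorem2:
  fixes k r p :: nat
  assumes "1 \<le> r" and "r \<le> k" and "r \<le> p"
  shows "\<exists>l::real. (\<lambda>n. real (lottery_number n k r p) / real (n choose r)) \<longlonglongrightarrow> l"
proof -
  define a where "a = (\<lambda>n. real (lottery_number n k r p) / real n ^ r)"
  have "\<exists>l. a \<longlonglongrightarrow> l"
  proof (rule convergent_of_self_bound)
    show "(\<lambda>n. real p / real n) \<longlonglongrightarrow> 0" by (rule lim_const_over_n)
    show "a n \<le> (a m + real p / real m) * (1 + real (m * (fact k + 1)) / real n) ^ r"
      if "k \<le> m" "k \<le> n" for m n
      using lottery_ratio_bound[OF assms that] by (simp add: a_def)
  qed (auto simp: a_def)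
  then obtain l where "a \<longlonglongrightarrow> l" ..
  then have "(\<lambda>n. a n * (real n ^ r / real (n choose r))) \<longlonglongrightarrow> l * fact r"
    by (rule tendsto_mult[OF _ power_over_binomial_tendsto])
  moreover have "\<forall>\<^sub>F n in sequentially. a n * (real n ^ r / real (n choose r))
      = real (lottery_number n k r p) / real (n choose r)"
    using eventually_gt_at_top[of 0] by eventually_elim (simp add: a_def)
  ultimately show ?thesis by (intro exI[of _ "l * fact r"]) (rule Lim_transform_eventually)
qed

end
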